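(* Let $n\ge4$ be even and let $D$ be the matrix in the context, $P=I_{2n-1}-\frac{1}{2n-1}J_{2n-1}$ and $U=-\frac12PDP$. Then $L_{even}=U^\dagger$.
   Context: $\mathbf{1}_p$ all-ones vector in $\mathbb{R}^p$, $J_p=\mathbf{1}_p\mathbf{1}_p'$, $I_p$ identity, $X'$ transpose, $X^\dagger$ Moore–Penrose inverse. $\mathrm{Circ}(a_1,\dots,a_p)$ is the circulant matrix with first row $(a_1,\dots,a_p)$, each subsequent row the previous one shifted cyclically one position to the right. $S=\mathrm{Circ}(1,3,\dots,3,1)$ (size $n-1$, $n-3$ threes), $T=\mathrm{Circ}(0,2,4,\dots,4,2)$ (size $n-1$, $n-4$ fours), \[D=\begin{bmatrix}0&\mathbf{1}_{n-1}'&2\mathbf{1}_{n-1}'\\ \mathbf{1}_{n-1}&2(J_{n-1}-I_{n-1})&S\\ 2\mathbf{1}_{n-1}&S'&T\end{bmatrix}\] (the distance matrix of the gear graph on $2n-1$ vertices). Let $\phi_k=\cos(\frac{\pi k}{n-1})$, $C_k=\mathrm{Circ}(1,\cos\frac{2\pi k}{n-1},\dots,\cos\frac{2\pi(n-2)k}{n-1})$, $\widetilde{C_k}=\mathrm{Circ}(\cos\frac{2\pi k}{n-1},\dots,\cos\frac{2\pi(n-2)k}{n-1},1)$, \[A=\frac{9(n-1)}{(n+4)^2}\begin{bmatrix}1&\frac{n-2}{3(n-1)}\mathbf{1}_{n-1}'&\frac{-(n+1)}{3(n-1)}\mathbf{1}_{n-1}'\\ \frac{n-2}{3(n-1)}\mathbf{1}_{n-1}&\frac{(n-2)^2}{9(n-1)^2}J_{n-1}&\frac{-(n-2)(n+1)}{9(n-1)^2}J_{n-1}\\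 \frac{-(n+1)}{3(n-1)}\mathbf{1}_{n-1}&\frac{-(n-2)(n+1)}{9(n-1)^2}J_{n-1}&\frac{(n+1)^2}{9(n-1)^2}J_{n-1}\end{bmatrix},\] \[B_k=\frac{2}{(n-1)(2\phi_k+\frac{1}{2\phi_k})^2}\begin{bmatrix}0&\mathbf{0}&\mathbf{0}\\ \mathbf{0}&\frac{C_k}{4\phi_k^2}&\frac{C_k+\widetilde{C_k}}{4\phi_k^2}\\ \mathbf{0}&\frac{C_k+\widetilde{C_k}'}{4\phi_k^2}&C_k\end{bmatrix},\] and $L_{even}=A+\sum_{k=1}^{(n-2)/2}B_k$. *)

theory Defs
  imports Complex_Main "Jordan_Normal_Form.Matrix"
begin

text \<open>Real matrices whose size depends on \<open>n\<close> are taken from \<open>Jordan_Normal_Form.Matrix\<close>;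
  vectors are one-column matrices, indices start at 0.\<close>

definition is_mp_inverse :: "real mat \<Rightarrow> real mat \<Rightarrow> bool" where
  "is_mp_inverse M X \<longleftrightarrow>
     X \<in> carrier_mat (dim_col M) (dim_row M) \<and>
     M * X * M = M \<and> X * M * X = X \<and> (M * X)\<^sup>T = M * X \<and> (X * M)\<^sup>T = X * M"

definition mp_inverse :: "real mat \<Rightarrow> real mat" where
  "mp_inverse M = (THE X. is_mp_inverse M X)"

lemma is_mp_inverse_unique:
  assumes X: "is_mp_inverse M X" and Y: "is_mp_inverse M Y"
  shows "X = Y"
proof -
  define r c where "r = dim_row M" and "c = dim_col M"
  have [simp]: "M \<in> carrier_mat r c" "X \<in> carrier_mat c r" "Y \<in> carrier_mat c r"
    using X Y unfolding is_mp_inverse_def r_def c_def by auto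
  have [simp]: "M * X \<in> carrier_mat r r" "M * Y \<in> carrier_mat r r"
    "X * M \<in> carrier_mat c c" "Y * M \<in> carrier_mat c c"
    by (auto intro: mult_carrier_mat[of _ _ c] mult_carrier_mat[of _ _ r])
  note x = X[unfolded is_mp_inverse_def] and y = Y[unfolded is_mp_inverse_def]
  have MX: "M * X = M * Y"
  proof -
    have "M * X = (M * Y * M) * X" using y by simp
    also have "\<dots> = (M * Y) * (M * X)" by (rule assoc_mult_mat[of _ r r _ c _ r]) auto
    also have "\<dots> = (M * Y)\<^sup>T * (M * X)\<^sup>T" using x y by simp
    also have "\<dots> = ((M * X) * (M * Y))\<^sup>T" by (rule transpose_mult[symmetric, of _ r r _ r]) auto
    also have "(M * X) * (M * Y) = (M * X * M) * Y"
      by (rule assoc_mult_mat[symmetric, of _ r r _ c _ r]) auto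
    also have "\<dots> = M * Y" using x by simp
    finally show ?thesis using y by simp
  qed
  have XM: "X * M = Y * M"
  proof -
    have "X * M = X * (M * Y * M)" using y by simp
    also have "\<dots> = X * (M * (Y * M))" by (simp add: assoc_mult_mat[of M r c Y r M c])
    also have "\<dots> = (X * M) * (Y * M)" by (rule assoc_mult_mat[symmetric, of _ c r _ c _ c]) auto
    also have "\<dots> = (X * M)\<^sup>T * (Y * M)\<^sup>T" using x y by simp
    also have "\<dots> = ((Y * M) * (X * M))\<^sup>T" by (rule transpose_mult[symmetric, of _ c c _ c]) auto
    also have "(Y * M) * (X * M) = Y * (M * (X * M))"
      by (rule assoc_mult_mat[of _ c r _ c _ c]) auto
    also have "M * (X * M) = M * X * M" by (rule assoc_mult_mat[symmetric, of _ r c _ r _ c]) auto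
    also have "\<dots> = M" using x by simp
    finally show ?thesis using y by simp
  qed
  have "X = X * M * X" using x by simp
  also have "\<dots> = Y * M * X" using XM by simp
  also have "\<dots> = Y * (M * X)" by (rule assoc_mult_mat[of _ c r _ c _ r]) auto
  also have "\<dots> = Y * (M * Y)" using MX by simp
  also have "\<dots> = Y * M * Y" by (rule assoc_mult_mat[symmetric, of _ c r _ c _ r]) auto
  also have "\<dots> = Y" using y by simp
  finally show ?thesis .
qed

lemma mp_inverse_eqI: "is_mp_inverse M X \<Longrightarrow> mp_inverse M = X"
  unfolding mp_inverse_def using is_mp_inverse_unique by blast

definition ones_col :: "nat \<Rightarrow> real mat" where
  "ones_col p = mat p 1 (\<lambda>_. 1)"

definition J_mat :: "nat \<Rightarrow> real mat" where
  "J_mat p = ones_col p * (ones_col p)\<^sup>T"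

text \<open>Row \<open>i\<close> is the first row shifted \<open>i\<close> places to the right, so entry \<open>(i, j)\<close> is
  entry \<open>j - i\<close> (mod \<open>p\<close>) of the first row; the summand \<open>p\<close> avoids truncated subtraction.\<close>

definition Circ :: "real list \<Rightarrow> real mat" where
  "Circ as = (let p = length as in mat p p (\<lambda>(i, j). as ! ((j + p - i) mod p)))"

definition three_block_mat ::
  "'a::zero mat \<Rightarrow> 'a mat \<Rightarrow> 'a mat \<Rightarrow>
   'a mat \<Rightarrow> 'a mat \<Rightarrow> 'a mat \<Rightarrow>
   'a mat \<Rightarrow> 'a mat \<Rightarrow> 'a mat \<Rightarrow> 'a mat" where
  "three_block_mat M11 M12 M13
                   M21 M22 M23
                   M31 M32 M33 =
     four_block_mat (four_block_mat M11 M12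
                                    M21 M22) (M13 @\<^sub>r M23)
                    ((M31\<^sup>T @\<^sub>r M32\<^sup>T)\<^sup>T)        M33"

definition gear_S :: "nat \<Rightarrow> real mat" where
  "gear_S n = Circ ([1] @ replicate (n - 3) 3 @ [1])"

definition gear_T :: "nat \<Rightarrow> real mat" where
  "gear_T n = Circ ([0, 2] @ replicate (n - 4) 4 @ [2])"

definition gear_D :: "nat \<Rightarrow> real mat" where
  "gear_D n = three_block_mat
     (0\<^sub>m 1 1)                   ((ones_col (n - 1))\<^sup>T)                          (2 \<cdot>\<^sub>m (ones_col (n - 1))\<^sup>T)
     (ones_col (n - 1))         (2 \<cdot>\<^sub>m (J_mat (n - 1) - 1\<^sub>m (n - 1)))            (gear_S n)
     (2 \<cdot>\<^sub>m ones_col (n - 1))    ((gear_S n)\<^sup>T)                                   (gear_T n)"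

definition gear_phi :: "nat \<Rightarrow> nat \<Rightarrow> real" where
  "gear_phi n k = cos (pi * real k / (real n - 1))"

definition gear_C :: "nat \<Rightarrow> nat \<Rightarrow> real mat" where
  "gear_C n k = Circ ([1] @ map (\<lambda>j. cos (2 * pi * real j * real k / (real n - 1))) [1..<n - 1])"

definition gear_C_tilde :: "nat \<Rightarrow> nat \<Rightarrow> real mat" where
  "gear_C_tilde n k = Circ (map (\<lambda>j. cos (2 * pi * real j * real k / (real n - 1))) [1..<n - 1] @ [1])"

definition gear_A :: "nat \<Rightarrow> real mat" where
  "gear_A n =
    (let m = n - 1;
         e = ones_col m;
         x = real n
     in (9 * (x - 1) / (x + 4)\<^sup>2) \<cdot>\<^sub>m three_block_mat
       (1\<^sub>m 1)
       (((x - 2) / (3 * (x - 1))) \<cdot>\<^sub>m e\<^sup>T)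
       ((- (x + 1) / (3 * (x - 1))) \<cdot>\<^sub>m e\<^sup>T)

       (((x - 2) / (3 * (x - 1))) \<cdot>\<^sub>m e)
       (((x - 2)\<^sup>2 / (9 * (x - 1)\<^sup>2)) \<cdot>\<^sub>m J_mat m)
       ((- (x - 2) * (x + 1) / (9 * (x - 1)\<^sup>2)) \<cdot>\<^sub>m J_mat m)

       ((- (x + 1) / (3 * (x - 1))) \<cdot>\<^sub>m e)
       ((- (x - 2) * (x + 1) / (9 * (x - 1)\<^sup>2)) \<cdot>\<^sub>m J_mat m)
       (((x + 1)\<^sup>2 / (9 * (x - 1)\<^sup>2)) \<cdot>\<^sub>m J_mat m))"

definition gear_B :: "nat \<Rightarrow> nat \<Rightarrow> real mat" where
  "gear_B n k =
    (let m = n - 1;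
         \<phi> = gear_phi n k
     in (2 / ((real n - 1) * (2 * \<phi> + 1 / (2 * \<phi>))\<^sup>2)) \<cdot>\<^sub>m three_block_mat
       (0\<^sub>m 1 1)
       (0\<^sub>m 1 m)
       (0\<^sub>m 1 m)

       (0\<^sub>m m 1)
       ((1 / (4 * \<phi>\<^sup>2)) \<cdot>\<^sub>m gear_C n k)
       ((1 / (4 * \<phi>\<^sup>2)) \<cdot>\<^sub>m (gear_C n k + gear_C_tilde n k))

       (0\<^sub>m m 1)
       ((1 / (4 * \<phi>\<^sup>2)) \<cdot>\<^sub>m (gear_C n k + (gear_C_tilde n k)\<^sup>T))
       (gear_C n k))"

text \<open>The type of matrices of arbitrary size has no zero, so the sum is the \<open>finsum\<close> of the
  additive structure on the matrices of order \<open>2 * n - 1\<close>.\<close>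

definition L_even :: "nat \<Rightarrow> real mat" where
  "L_even n = gear_A n +
     finsum (module_mat TYPE(real) (2 * n - 1) (2 * n - 1)) (gear_B n) {1..(n - 2) div 2}"

end

theory Submission
  imports Defs "Jordan_Normal_Form.Determinant"
begin

text \<open>Put \<open>m = n - 1\<close>. Let \<open>V\<close> be the \<open>(2m+1) \<times> m\<close> matrix whose rows are \<open>0\<close>, then the unit
  vectors \<open>e\<^sub>i\<close>, then the sums \<open>e\<^sub>i + e\<^sub>i\<^sub>+\<^sub>1\<close> (indices modulo \<open>m\<close>), and let \<open>a = V\<one> = (0, 1, 2)\<close>
  blockwise. Then \<open>D = \<one>a' + a\<one>' - 2VV'\<close>, and \<open>P\<one> = 0\<close> gives \<open>U = WW'\<close> with \<open>W = PV\<close>. The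
  Gram matrix \<open>G = W'W\<close> is circulant and invertible, with eigenvalue \<open>(m+5)/(2m+1)\<close> on constants
  and \<open>3 + 2 cos(2\<pi>k/m) = 1 + 4\<phi>\<^sub>k\<^sup>2\<close> on the \<open>k\<close>-th Fourier mode, so the Moore-Penrose inverse of
  \<open>U\<close> is \<open>W G\<^sup>-\<^sup>2 W'\<close>. Expanding \<open>G\<^sup>-\<^sup>2\<close> in cosines, the constant term yields \<open>A\<close> and the
  \<open>k\<close>-th cosine yields \<open>B\<^sub>k\<close>.\<close>

section \<open>Moore-Penrose inverses of matrices of the form \<open>W * W\<^sup>T\<close>\<close>

text \<open>For \<open>G = W\<^sup>T * W\<close> the assumption \<open>inv\<close> says that
  \<open>X\<close> is the inverse square of \<open>G\<close>. Both products of
  \<open>W * W\<^sup>T\<close> with the candidate then equal \<open>W * K * W\<^sup>T\<close>, where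
  \<open>K\<close> is the inverse of \<open>G\<close>; this is the orthogonal projection onto the
  column space of \<open>W\<close>.\<close>

lemma is_mp_inverse_gram:
  assumes W: "W \<in> carrier_mat r c" and X: "X \<in> carrier_mat c c"
    and inv: "(W\<^sup>T * W) * ((W\<^sup>T * W) * X) = 1\<^sub>m c"
  shows "is_mp_inverse (W * W\<^sup>T) (W * X * W\<^sup>T)"
proof -
  define G where "G = W\<^sup>T * W"
  have G: "G \<in> carrier_mat c c" and Wt: "W\<^sup>T \<in> carrier_mat c r" using W by (auto simp: G_def)
  have GX: "G * X \<in> carrier_mat c c" "X * G \<in> carrier_mat c c" using G X by auto
  note carrier = W X G Wt GX
  have symG: "G\<^sup>T = G"
    unfolding G_def using transpose_mult[OF Wt W] by simp
  have GGX: "G * (G * X) = 1\<^sub>m c" using inv by (simp add: G_def)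
  have GXG: "(G * X) * G = 1\<^sub>m c"
    by (rule mat_mult_left_right_inverse[OF G GX(1) GGX])
  \<comment> \<open>\<open>X * G\<close> is a left inverse of \<open>G\<close> and
    \<open>G * X\<close> a right inverse, so they coincide.\<close>
  have commute: "G * X = X * G"
  proof -
    have "G * (X * G) = 1\<^sub>m c" using GXG G X by (simp add: assoc_mult_mat[of _ c c _ c _ c])
    then have "(X * G) * G = 1\<^sub>m c" by (rule mat_mult_left_right_inverse[OF G GX(2)])
    then have "G * X = ((X * G) * G) * (G * X)" using left_mult_one_mat[OF GX(1)] by simp
    also have "\<dots> = (X * G) * (G * (G * X))" by (rule assoc_mult_mat) (use carrier in auto)
    also have "\<dots> = X * G" unfolding GGX by (rule right_mult_one_mat[OF GX(2)])
    finally show ?thesis .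
  qed
  \<comment> \<open>The transpose of \<open>G * X\<close> is a left inverse of the symmetric
    \<open>G\<close>, hence again its inverse.\<close>
  have symX: "(G * X)\<^sup>T = G * X"
  proof -
    have "(G * X)\<^sup>T * G = (G * (G * X))\<^sup>T"
      using transpose_mult[OF G GX(1)] symG by simp
    then have *: "(G * X)\<^sup>T * G = 1\<^sub>m c" by (simp add: GGX)
    have "(G * X)\<^sup>T = (G * X)\<^sup>T * (G * (G * X))"
      using GGX GX by (metis right_mult_one_mat transpose_carrier_mat)
    also have "\<dots> = ((G * X)\<^sup>T * G) * (G * X)"
      by (rule assoc_mult_mat[symmetric]) (use carrier in auto)
    also have "\<dots> = G * X" unfolding * by (rule left_mult_one_mat[OF GX(1)])
    finally show ?thesis .
  qed
  define K where "K = G * X"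
  have K: "K \<in> carrier_mat c c" using GX by (simp add: K_def)
  \<comment> \<open>Multiplying two such triple products puts \<open>G\<close> between their middle
    factors, so the multiplicative Penrose equations reduce to identities among square matrices of
    order \<open>c\<close>.\<close>
  have sandwich: "(W * A * W\<^sup>T) * (W * B * W\<^sup>T) = W * (A * (G * B)) * W\<^sup>T"
    if A: "A \<in> carrier_mat c c" and B: "B \<in> carrier_mat c c" for A B
  proof -
    have WA: "W * A \<in> carrier_mat r c" and WB: "W * B \<in> carrier_mat r c"
      and WBW: "W * B * W\<^sup>T \<in> carrier_mat r r" and GB: "G * B \<in> carrier_mat c c"
      using W A B G Wt by auto
    have "(W * A * W\<^sup>T) * (W * B * W\<^sup>T) = (W * A) * (W\<^sup>T * (W * B * W\<^sup>T))"
      by (rule assoc_mult_mat[OF WA Wt WBW])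
    also have "W\<^sup>T * (W * B * W\<^sup>T) = (W\<^sup>T * (W * B)) * W\<^sup>T"
      by (rule assoc_mult_mat[OF Wt WB Wt, symmetric])
    also have "W\<^sup>T * (W * B) = G * B"
      unfolding G_def by (rule assoc_mult_mat[OF Wt W B, symmetric])
    also have "(W * A) * ((G * B) * W\<^sup>T) = ((W * A) * (G * B)) * W\<^sup>T"
      by (rule assoc_mult_mat[OF WA GB Wt, symmetric])
    also have "(W * A) * (G * B) = W * (A * (G * B))"
      by (rule assoc_mult_mat[OF W A GB])
    finally show ?thesis .
  qed
  have WW: "W * W\<^sup>T = W * 1\<^sub>m c * W\<^sup>T" using W by simp
  have ULE: "(W * W\<^sup>T) * (W * X * W\<^sup>T) = W * K * W\<^sup>T"
    unfolding WW using sandwich[OF one_carrier_mat X] left_mult_one_mat[OF GX(1)] by (simp add: K_def)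
  have LUE: "(W * X * W\<^sup>T) * (W * W\<^sup>T) = W * K * W\<^sup>T"
    unfolding WW using sandwich[OF X one_carrier_mat] G by (simp add: K_def commute)
  have symE: "(W * K * W\<^sup>T)\<^sup>T = W * K * W\<^sup>T"
  proof -
    have WK: "W * K \<in> carrier_mat r c" using W K by auto
    have "(W * K * W\<^sup>T)\<^sup>T = W * (W * K)\<^sup>T" using transpose_mult[OF WK Wt] by simp
    also have "(W * K)\<^sup>T = K * W\<^sup>T" using transpose_mult[OF W K] symX by (simp add: K_def)
    also have "W * (K * W\<^sup>T) = W * K * W\<^sup>T" by (rule assoc_mult_mat[OF W K Wt, symmetric])
    finally show ?thesis .
  qed
  have "(W * K * W\<^sup>T) * (W * W\<^sup>T) = W * W\<^sup>T"
    unfolding WW using sandwich[OF K one_carrier_mat] G GXG by (simp add: K_def)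
  moreover have "(W * K * W\<^sup>T) * (W * X * W\<^sup>T) = W * X * W\<^sup>T"
  proof -
    have "K * (G * X) = X * (G * (G * X))"
      unfolding K_def commute[symmetric] unfolding commute by (rule assoc_mult_mat) (use carrier in auto)
    also have "\<dots> = X" using GGX X by simp
    finally show ?thesis using sandwich[OF K X] by simp
  qed
  ultimately show ?thesis
    unfolding is_mp_inverse_def ULE LUE using symE W by auto
qed

section \<open>Periodic functions and the rows of \<open>V\<close>\<close>

text \<open>Row \<open>p\<close> of \<open>V\<close> applied to a vector. Vectors and circulant symbols are \<open>m\<close>-periodic functions
  on the integers, which keeps \<open>mod\<close> out of the index arithmetic.\<close>

definition inc_row :: "nat \<Rightarrow> nat \<Rightarrow> (int \<Rightarrow> real) \<Rightarrow> real" where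
  "inc_row m p f = (if p = 0 then 0 else if p \<le> m then f (int p - 1)
     else f (int p - int m - 1) + f (int p - int m))"

text \<open>Kronecker delta on residue classes: its translates are the periodic unit vectors, and as
  a circulant symbol it gives the identity matrix.\<close>

definition delta_mod :: "nat \<Rightarrow> int \<Rightarrow> real" where
  "delta_mod m x = of_bool (int m dvd x)"

definition inc_mat :: "nat \<Rightarrow> real mat" where
  "inc_mat m = mat (2 * m + 1) m (\<lambda>(p, j). inc_row m p (\<lambda>x. delta_mod m (x - int j)))"

text \<open>The symbol is evaluated at row minus column, opposite to \<open>Circ\<close>. Cosine
  series are even, so for them the two conventions agree.\<close>

definition circ_mat :: "nat \<Rightarrow> (int \<Rightarrow> real) \<Rightarrow> real mat" where
  "circ_mat m f = mat m m (\<lambda>(i, j). f (int i - int j))"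

definition periodic :: "nat \<Rightarrow> (int \<Rightarrow> real) \<Rightarrow> bool" where
  "periodic m f \<longleftrightarrow> (\<forall>x y. int m dvd x - y \<longrightarrow> f x = f y)"

text \<open>Iterating the shift reaches every nonnegative multiple of \<open>m\<close>; a negative
  multiple is the same statement with the two arguments exchanged.\<close>

lemma periodicI:
  assumes "\<And>x. f (x + int m) = f x"
  shows "periodic m f"
proof -
  have step: "f (x + int m * int k) = f x" for x k
  proof (induction k)
    case (Suc k)
    have "x + int m * int (Suc k) = (x + int m * int k) + int m" by (simp add: algebra_simps)
    then show ?case using Suc assms by metis
  qed simp
  have "f x = f y" if dv: "int m dvd x - y" for x y
  proof -
    obtain c where c: "x - y = int m * c" using dv by (rule dvdE)
    show ?thesis
    proof (cases "c \<ge> 0")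
      case True
      then show ?thesis using step[of y "nat c"] c by (simp add: algebra_simps)
    next
      case False
      then show ?thesis using step[of x "nat (- c)"] c by (simp add: algebra_simps)
    qed
  qed
  then show ?thesis by (simp add: periodic_def)
qed

lemma periodicD: "periodic m f \<Longrightarrow> int m dvd x - y \<Longrightarrow> f x = f y"
  unfolding periodic_def by blast

lemma periodic_reflect:
  assumes "periodic m f"
  shows "periodic m (\<lambda>x. f (c - x))"
proof -
  have "f (c - x) = f (c - y)" if "int m dvd x - y" for x y
    by (rule periodicD[OF assms]) (use that in \<open>simp add: dvd_diff_commute\<close>)
  then show ?thesis by (simp add: periodic_def)
qed

lemma periodic_shift: "periodic m f \<Longrightarrow> periodic m (\<lambda>x. f (x + c))"
  by (simp add: periodic_def)

lemma periodic_delta_mod: "periodic m (delta_mod m)"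
  by (rule periodicI) (simp add: delta_mod_def)

lemma delta_mod_commute: "delta_mod m (x - y) = delta_mod m (y - x)"
  by (simp add: delta_mod_def dvd_diff_commute)

text \<open>Exactly one \<open>j < m\<close> is congruent to \<open>x\<close>, namely
  \<open>x mod m\<close>, and periodicity replaces that residue by \<open>x\<close>.\<close>

lemma sum_delta_mod:
  assumes "m > 0" and f: "periodic m f"
  shows "(\<Sum>j<m. delta_mod m (x - int j) * f (int j)) = f x"
proof -
  define j0 where "j0 = nat (x mod int m)"
  have j0: "j0 < m" "int j0 = x mod int m" using assms(1) by (auto simp: j0_def nat_less_iff)
  have "delta_mod m (x - int j) = of_bool (j = j0)" if "j < m" for j
  proof -
    have "int m dvd x - int j \<longleftrightarrow> x mod int m = int j mod int m" by (simp add: mod_eq_dvd_iff)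
    also have "\<dots> \<longleftrightarrow> j = j0" using that j0 by auto
    finally show ?thesis by (simp add: delta_mod_def)
  qed
  then have "(\<Sum>j<m. delta_mod m (x - int j) * f (int j)) = (\<Sum>j<m. if j = j0 then f (int j) else 0)"
    by (intro sum.cong) auto
  also have "\<dots> = f (int j0)" using j0(1) by simp
  also have "\<dots> = f x" by (rule periodicD[OF f]) (simp add: j0 mod_eq_dvd_iff[symmetric])
  finally show ?thesis .
qed

lemma inc_row_add: "inc_row m p (\<lambda>x. f x + g x) = inc_row m p f + inc_row m p g"
  and inc_row_mult: "inc_row m p (\<lambda>x. c * f x) = c * inc_row m p f"
  by (simp_all add: inc_row_def algebra_simps)

lemma inc_row_sum: "inc_row m p (\<lambda>x. \<Sum>j\<in>A. f j x) = (\<Sum>j\<in>A. inc_row m p (f j))"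
  by (simp add: inc_row_def sum.distrib)

lemma inc_row_const: "inc_row m p (\<lambda>x. c) = c * inc_row m p (\<lambda>_. 1)"
  by (simp add: inc_row_def)

lemma periodic_inc_row:
  assumes "\<And>x. periodic m (f x)"
  shows "periodic m (\<lambda>y. inc_row m p (\<lambda>x. f x y))"
proof -
  have "f x y = f x z" if "int m dvd y - z" for x y z
    using periodicD[OF assms that] .
  then show ?thesis unfolding periodic_def inc_row_def by auto
qed

text \<open>The left side is row \<open>p\<close> of \<open>V\<close> times the vector of values of
  \<open>f\<close>. As \<open>inc_row\<close> is linear, the sum moves inside and collapses, so
  products with \<open>V\<close> can be computed on functions.\<close>

lemma sum_inc_row_delta:
  assumes "m > 0" and f: "periodic m f"
  shows "(\<Sum>j<m. inc_row m p (\<lambda>x. delta_mod m (x - int j)) * f (int j)) = inc_row m p f"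
proof -
  have "(\<Sum>j<m. inc_row m p (\<lambda>x. delta_mod m (x - int j)) * f (int j))
    = inc_row m p (\<lambda>x. \<Sum>j<m. f (int j) * delta_mod m (x - int j))"
    by (simp add: inc_row_sum inc_row_mult mult.commute)
  also have "\<dots> = inc_row m p f"
    using sum_delta_mod[OF assms] by (simp add: mult.commute)
  finally show ?thesis .
qed

text \<open>The vertices come in the order hub, the \<open>m\<close> neighbours of the hub, the
  \<open>m\<close> vertices at distance two from it.\<close>

lemma sum_vertices:
  fixes g :: "nat \<Rightarrow> real"
  shows "(\<Sum>p<2 * m + 1. g p) = g 0 + (\<Sum>i<m. g (Suc i)) + (\<Sum>i<m. g (Suc (m + i)))"
proof -
  have "(\<Sum>p<2 * m + 1. g p) = g 0 + (\<Sum>p<m + m. g (Suc p))"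
    by (simp add: sum.lessThan_Suc_shift mult_2 del: sum.lessThan_Suc)
  also have "(\<Sum>p<m + m. g (Suc p)) = (\<Sum>i<m. g (Suc i)) + (\<Sum>i<m. g (Suc (m + i)))"
    using sum.atLeastLessThan_concat[of 0 m "m + m" "\<lambda>p. g (Suc p)"]
      sum.shift_bounds_nat_ivl[of "\<lambda>p. g (Suc p)" 0 m m]
    by (simp add: atLeast0LessThan add.commute)
  finally show ?thesis by simp
qed

text \<open>This is the action of \<open>V'V\<close>. Column \<open>j\<close> of \<open>V\<close>
  meets one row of the first ring, contributing \<open>f j\<close>, and rows \<open>j\<close> and
  \<open>j - 1\<close> of the second ring, contributing \<open>f j + f (j + 1)\<close> and
  \<open>f (j - 1) + f j\<close>.\<close>

lemma sum_inc_row_inc_row: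
  assumes "m > 0" and f: "periodic m f"
  shows "(\<Sum>p<2 * m + 1. inc_row m p (\<lambda>x. delta_mod m (x - j)) * inc_row m p f)
    = 3 * f j + f (j + 1) + f (j - 1)"
proof -
  have g: "periodic m (\<lambda>x. f x + f (x + 1))"
    using f periodic_shift[OF f, of 1] by (simp add: periodic_def)
  have *: "(\<Sum>i<m. delta_mod m (int i - y) * h (int i)) = h y" if "periodic m h" for h y
    using sum_delta_mod[OF assms(1) that, of y] by (simp add: delta_mod_commute)
  have "(\<Sum>p<2 * m + 1. inc_row m p (\<lambda>x. delta_mod m (x - j)) * inc_row m p f)
    = (\<Sum>i<m. delta_mod m (int i - j) * f (int i))
      + (\<Sum>i<m. delta_mod m (int i - j) * (f (int i) + f (int i + 1)))
      + (\<Sum>i<m. delta_mod m (int i - (j - 1)) * (f (int i) + f (int i + 1)))"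
    unfolding sum_vertices by (simp add: inc_row_def algebra_simps sum.distrib)
  also have "\<dots> = 3 * f j + f (j + 1) + f (j - 1)"
    unfolding *[OF f] *[OF g] by simp
  finally show ?thesis .
qed

lemma sum_inc_row:
  "(\<Sum>p<2 * m + 1. inc_row m p f) = 2 * (\<Sum>i<m. f (int i)) + (\<Sum>i<m. f (int i + 1))"
  unfolding sum_vertices by (simp add: inc_row_def sum.distrib algebra_simps)

lemma sum_inc_row_delta_col:
  assumes "m > 0"
  shows "(\<Sum>p<2 * m + 1. inc_row m p (\<lambda>x. delta_mod m (x - j))) = 3"
proof -
  have *: "(\<Sum>i<m. delta_mod m (int i - y)) = 1" for y
    using sum_delta_mod[of m "\<lambda>_. 1" y] assms by (simp add: periodic_def delta_mod_commute)
  show ?thesis unfolding sum_inc_row using *[of j] *[of "j - 1"] by (simp add: algebra_simps)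
qed


section \<open>Products of circulants with \<open>V\<close> and with \<open>W = PV\<close>\<close>

text \<open>\<open>W = PV\<close>: every column of \<open>V\<close> sums to \<open>3\<close>.\<close>

definition proj_inc_mat :: "nat \<Rightarrow> real mat" where
  "proj_inc_mat m = mat (2 * m + 1) m
     (\<lambda>(p, j). inc_row m p (\<lambda>x. delta_mod m (x - int j)) - 3 / (2 * real m + 1))"

lemma inc_mat_carrier: "inc_mat m \<in> carrier_mat (2 * m + 1) m"
  and proj_inc_mat_carrier: "proj_inc_mat m \<in> carrier_mat (2 * m + 1) m"
  and circ_mat_carrier: "circ_mat m f \<in> carrier_mat m m"
  by (simp_all add: inc_mat_def proj_inc_mat_def circ_mat_def)

lemma index_mult_mat_sum:
  assumes "A \<in> carrier_mat r c" "B \<in> carrier_mat c s" "i < r" "j < s"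
  shows "(A * B) $$ (i, j) = (\<Sum>l<c. A $$ (i, l) * B $$ (l, j))"
  using assms by (simp add: scalar_prod_def atLeast0LessThan)

lemma inc_mat_circ_index:
  assumes "m > 0" "periodic m f" "p < 2 * m + 1" "j < m"
  shows "(inc_mat m * circ_mat m f) $$ (p, j) = inc_row m p (\<lambda>x. f (x - int j))"
proof -
  have "(inc_mat m * circ_mat m f) $$ (p, j)
    = (\<Sum>l<m. inc_row m p (\<lambda>x. delta_mod m (x - int l)) * f (int l - int j))"
    unfolding index_mult_mat_sum[OF inc_mat_carrier circ_mat_carrier assms(3,4)]
    using assms by (simp add: inc_mat_def circ_mat_def)
  also have "\<dots> = inc_row m p (\<lambda>x. f (x - int j))"
    using sum_inc_row_delta[OF assms(1) periodic_shift[OF assms(2), of "- int j"]] by simp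
  finally show ?thesis .
qed

text \<open>\<open>sum_inc_row_delta\<close> is used once per factor \<open>V\<close>; for the
  second use the sum runs over the subtracted argument, hence the reflected symbol in
  \<open>per\<close>.\<close>

lemma inc_mat_circ_inc_index:
  assumes "m > 0" "periodic m f" "p < 2 * m + 1" "q < 2 * m + 1"
  shows "(inc_mat m * circ_mat m f * (inc_mat m)\<^sup>T) $$ (p, q)
    = inc_row m q (\<lambda>y. inc_row m p (\<lambda>x. f (x - y)))"
proof -
  have per: "periodic m (\<lambda>y. inc_row m p (\<lambda>x. f (x - y)))"
    by (rule periodic_inc_row) (rule periodic_reflect[OF assms(2)])
  have VF: "inc_mat m * circ_mat m f \<in> carrier_mat (2 * m + 1) m"
    and Vt: "(inc_mat m)\<^sup>T \<in> carrier_mat m (2 * m + 1)"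
    using inc_mat_carrier[of m] circ_mat_carrier[of m f] by auto
  have "(inc_mat m * circ_mat m f * (inc_mat m)\<^sup>T) $$ (p, q)
    = (\<Sum>j<m. inc_row m p (\<lambda>x. f (x - int j)) * inc_row m q (\<lambda>x. delta_mod m (x - int j)))"
    unfolding index_mult_mat_sum[OF VF Vt assms(3,4)]
    by (intro sum.cong refl arg_cong2[where f = "(*)"] inc_mat_circ_index)
      (use assms in \<open>auto simp: inc_mat_def\<close>)
  also have "\<dots> = inc_row m q (\<lambda>y. inc_row m p (\<lambda>x. f (x - y)))"
    using sum_inc_row_delta[OF assms(1) per, of q] by (simp add: mult.commute)
  finally show ?thesis .
qed

text \<open>\<open>W\<close> differs from \<open>V\<close> by a constant matrix, which sees the
  circulant only through its common column sum \<open>s\<close>.\<close>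

lemma proj_inc_mat_circ_index:
  assumes "m > 0" "periodic m f" "\<And>y. (\<Sum>l<m. f (int l - y)) = s" "p < 2 * m + 1" "j < m"
  shows "(proj_inc_mat m * circ_mat m f) $$ (p, j)
    = inc_row m p (\<lambda>x. f (x - int j)) - 3 * s / (2 * real m + 1)"
proof -
  have "(proj_inc_mat m * circ_mat m f) $$ (p, j)
    = (\<Sum>l<m. (inc_row m p (\<lambda>x. delta_mod m (x - int l)) - 3 / (2 * real m + 1)) * f (int l - int j))"
    unfolding index_mult_mat_sum[OF proj_inc_mat_carrier circ_mat_carrier assms(4,5)]
    using assms(4,5) by (simp add: proj_inc_mat_def circ_mat_def)
  also have "\<dots> = (\<Sum>l<m. inc_row m p (\<lambda>x. delta_mod m (x - int l)) * f (int l - int j))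
      - 3 / (2 * real m + 1) * (\<Sum>l<m. f (int l - int j))"
    by (simp add: left_diff_distrib sum_subtractf sum_distrib_left)
  also have "\<dots> = inc_row m p (\<lambda>x. f (x - int j)) - 3 / (2 * real m + 1) * s"
    using sum_inc_row_delta[OF assms(1) periodic_shift[OF assms(2), of "- int j"]] assms(3) by simp
  finally show ?thesis by simp
qed

text \<open>The Gram matrix is again circulant, so it acts on symbols: \<open>V'V\<close> adds the
  two neighbours to three times the value, and the projection subtracts a constant.\<close>

lemma gram_mult_circ:
  assumes "m > 0" "periodic m f" and s: "\<And>y. (\<Sum>l<m. f (int l - y)) = s"
  shows "(proj_inc_mat m)\<^sup>T * proj_inc_mat m * circ_mat m f
    = circ_mat m (\<lambda>x. 3 * f x + f (x + 1) + f (x - 1) - 9 * s / (2 * real m + 1))"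
    (is "?L = circ_mat m ?g")
proof (rule eq_matI)
  let ?W = "proj_inc_mat m" and ?M = "2 * real m + 1"
  have Wt: "?W\<^sup>T \<in> carrier_mat m (2 * m + 1)" and WF: "?W * circ_mat m f \<in> carrier_mat (2 * m + 1) m"
    using proj_inc_mat_carrier[of m] circ_mat_carrier[of m f] by auto
  fix i j assume "i < dim_row (circ_mat m ?g)" "j < dim_col (circ_mat m ?g)"
  then have ij: "i < m" "j < m" by (auto simp: circ_mat_def)
  let ?v = "\<lambda>p. inc_row m p (\<lambda>x. delta_mod m (x - int i))" and ?h = "\<lambda>x. f (x - int j)"
  have per: "periodic m ?h" using periodic_shift[OF assms(2), of "- int j"] by simp
  have sum_h: "(\<Sum>p<2 * m + 1. inc_row m p ?h) = 3 * s"
    unfolding sum_inc_row using s[of "int j"] s[of "int j - 1"] by (simp add: algebra_simps)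
  have "?M \<noteq> 0" by linarith
  then have const: "?M * (3 / ?M * (3 * s / ?M)) = 9 * s / ?M" by simp
  have "?L $$ (i, j) = (?W\<^sup>T * (?W * circ_mat m f)) $$ (i, j)"
    using assoc_mult_mat[OF Wt proj_inc_mat_carrier circ_mat_carrier] by simp
  also have "\<dots> = (\<Sum>p<2 * m + 1. ?W\<^sup>T $$ (i, p) * (?W * circ_mat m f) $$ (p, j))"
    by (rule index_mult_mat_sum[OF Wt WF ij])
  also have "\<dots> = (\<Sum>p<2 * m + 1. (?v p - 3 / ?M) * (inc_row m p ?h - 3 * s / ?M))"
    by (intro sum.cong refl arg_cong2[where f = "(*)"] proj_inc_mat_circ_index)
      (use assms ij in \<open>auto simp: proj_inc_mat_def\<close>)
  \<comment> \<open>Each of the two cross terms equals \<open>9 * s / ?M\<close> with a minus sign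
    and the constant term equals it with a plus sign, so one copy remains subtracted.\<close>
  also have "\<dots> = (\<Sum>p<2 * m + 1. ?v p * inc_row m p ?h) - 3 * s / ?M * (\<Sum>p<2 * m + 1. ?v p)
      - 3 / ?M * (\<Sum>p<2 * m + 1. inc_row m p ?h) + ?M * (3 / ?M * (3 * s / ?M))"
    by (simp add: algebra_simps sum.distrib sum_subtractf sum_distrib_left del: sum.lessThan_Suc)
  also have "\<dots> = ?g (int i - int j)"
    unfolding sum_inc_row_inc_row[OF assms(1) per] sum_inc_row_delta_col[OF assms(1)] sum_h const
    by (simp add: algebra_simps)
  finally show "?L $$ (i, j) = circ_mat m ?g $$ (i, j)" using ij by (simp add: circ_mat_def)
qed (simp_all add: proj_inc_mat_def circ_mat_def)

lemma proj_inc_circ_proj_inc_index: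
  assumes "m > 0" "periodic m f" and s: "\<And>y. (\<Sum>l<m. f (int l - y)) = s"
    and even: "\<And>x. f (- x) = f x" and pq: "p < 2 * m + 1" "q < 2 * m + 1"
  shows "(proj_inc_mat m * circ_mat m f * (proj_inc_mat m)\<^sup>T) $$ (p, q)
    = inc_row m q (\<lambda>y. inc_row m p (\<lambda>x. f (x - y)))
      - 3 * s / (2 * real m + 1) * (inc_row m p (\<lambda>_. 1) + inc_row m q (\<lambda>_. 1))
      + 9 * s * real m / (2 * real m + 1)\<^sup>2"
proof -
  let ?W = "proj_inc_mat m" and ?M = "2 * real m + 1"
  let ?v = "\<lambda>j. inc_row m q (\<lambda>x. delta_mod m (x - int j))" and ?y = "\<lambda>y. inc_row m p (\<lambda>x. f (x - y))"
  have Wt: "?W\<^sup>T \<in> carrier_mat m (2 * m + 1)" and WF: "?W * circ_mat m f \<in> carrier_mat (2 * m + 1) m"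
    using proj_inc_mat_carrier[of m] circ_mat_carrier[of m f] by auto
  have per: "periodic m ?y"
    by (rule periodic_inc_row) (rule periodic_reflect[OF assms(2)])
  \<comment> \<open>The assumption on \<open>s\<close> concerns column sums; evenness turns them
    into the row sums needed here.\<close>
  have "f (x - y) = f (y - x)" for x y using even[of "x - y"] by simp
  then have "(\<Sum>l<m. f (x - int l)) = s" for x using s[of x] by simp
  then have sum_y: "(\<Sum>j<m. ?y (int j)) = s * inc_row m p (\<lambda>_. 1)"
    by (simp add: inc_row_sum[symmetric] inc_row_const[of m p s, symmetric])
  have sum_v: "(\<Sum>j<m. ?v j) = inc_row m q (\<lambda>_. 1)"
    using sum_inc_row_delta[of m "\<lambda>_. 1" q] assms(1) by (simp add: periodic_def)
  have "(?W * circ_mat m f * ?W\<^sup>T) $$ (p, q) = (\<Sum>j<m. (?W * circ_mat m f) $$ (p, j) * ?W\<^sup>T $$ (j, q))"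
    by (rule index_mult_mat_sum[OF WF Wt pq])
  also have "\<dots> = (\<Sum>j<m. (?y (int j) - 3 * s / ?M) * (?v j - 3 / ?M))"
    by (intro sum.cong refl arg_cong2[where f = "(*)"] proj_inc_mat_circ_index)
      (use assms in \<open>auto simp: proj_inc_mat_def\<close>)
  also have "\<dots> = (\<Sum>j<m. ?v j * ?y (int j)) - 3 * s / ?M * (\<Sum>j<m. ?v j)
      - 3 / ?M * (\<Sum>j<m. ?y (int j)) + real m * (3 / ?M * (3 * s / ?M))"
    by (simp add: algebra_simps sum.distrib sum_subtractf sum_distrib_left sum_divide_distrib)
  also have "\<dots> = inc_row m q ?y - 3 * s / ?M * (inc_row m p (\<lambda>_. 1) + inc_row m q (\<lambda>_. 1))
      + 9 * s * real m / ?M\<^sup>2"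
    unfolding sum_inc_row_delta[OF assms(1) per] sum_v sum_y
    by (simp add: algebra_simps add_divide_distrib power2_eq_square)
  finally show ?thesis .
qed

section \<open>Cosine series on an odd cycle\<close>

text \<open>Modes \<open>k\<close> and \<open>m - k\<close> give the same cosine at integers, so for
  odd \<open>m\<close> half of the frequencies expand every even periodic function.\<close>

definition cos_series :: "nat \<Rightarrow> real \<Rightarrow> (nat \<Rightarrow> real) \<Rightarrow> int \<Rightarrow> real" where
  "cos_series m \<alpha> \<beta> x = \<alpha> + (\<Sum>k = 1..(m - 1) div 2. \<beta> k * cos (2 * pi * real k * of_int x / real m))"

lemma periodic_cos:
  assumes "m > 0"
  shows "periodic m (\<lambda>x. cos (2 * pi * real k * of_int x / real m))"
proof (rule periodicI)
  fix x :: int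
  have "2 * pi * real k * of_int (x + int m) / real m = 2 * pi * real k * of_int x / real m + 2 * pi * of_int (int k)"
    using assms by (simp add: field_simps)
  then show "cos (2 * pi * real k * of_int (x + int m) / real m) = cos (2 * pi * real k * of_int x / real m)"
    by (simp only: cos_add sin_int_2pin cos_int_2pin mult_1_right mult_zero_right diff_zero)
qed

lemma periodic_cos_series: "m > 0 \<Longrightarrow> periodic m (cos_series m \<alpha> \<beta>)"
  using periodic_cos unfolding periodic_def cos_series_def
  by (intro allI impI arg_cong2[where f = "(+)"] sum.cong arg_cong2[where f = "(*)"] refl) blast

text \<open>Multiplied by \<open>2 * sin (\<theta> / 2)\<close>, the sum telescopes; this factor is
  nonzero because \<open>0 < k < m\<close>.\<close>

lemma sum_cos_full_period:
  fixes y :: real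
  assumes "0 < k" "k < m"
  shows "(\<Sum>l<m. cos (2 * pi * real k * (real l - y) / real m)) = 0"
proof -
  define \<theta> where "\<theta> = 2 * pi * real k / real m"
  define g where "g l = sin (\<theta> * (real l - y) - \<theta> / 2)" for l
  have "0 < \<theta> / 2" "\<theta> / 2 < pi" using assms by (auto simp: \<theta>_def field_simps)
  then have nz: "sin (\<theta> / 2) > 0" by (rule sin_gt_zero)
  have "2 * sin (\<theta> / 2) * cos (\<theta> * (real l - y)) = g (Suc l) - g l" for l
  proof -
    have "g (Suc l) = sin (\<theta> * (real l - y) + \<theta> / 2)"
      unfolding g_def by (rule arg_cong[where f = sin]) (simp add: algebra_simps)
    then show ?thesis by (simp add: g_def sin_add sin_diff)
  qed
  then have "2 * sin (\<theta> / 2) * (\<Sum>l<m. cos (\<theta> * (real l - y))) = g m - g 0"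
    by (simp add: sum_distrib_left sum_lessThan_telescope)
  \<comment> \<open>The two ends of the telescope differ by \<open>k\<close> full turns.\<close>
  also have "\<theta> * (real m - y) - \<theta> / 2 = (\<theta> * (real 0 - y) - \<theta> / 2) + 2 * pi * of_int (int k)"
    using assms by (simp add: \<theta>_def field_simps)
  then have "g m = g 0"
    unfolding g_def by (simp only: sin_add sin_int_2pin cos_int_2pin mult_1_right mult_zero_right add_0_right)
  finally have "(\<Sum>l<m. cos (\<theta> * (real l - y))) = 0" using nz by simp
  then show ?thesis by (simp add: \<theta>_def)
qed

text \<open>Only the constant mode survives a full period. This supplies the column sum
  \<open>s\<close> for the product formulas.\<close>

lemma sum_cos_series: "(\<Sum>l<m. cos_series m \<alpha> \<beta> (int l - y)) = real m * \<alpha>"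
proof -
  have "(\<Sum>l<m. cos_series m \<alpha> \<beta> (int l - y)) = real m * \<alpha> + (\<Sum>k = 1..(m - 1) div 2.
      \<beta> k * (\<Sum>l<m. cos (2 * pi * real k * (real l - of_int y) / real m)))"
    unfolding cos_series_def sum.distrib
    by (subst sum.swap) (simp add: sum_distrib_left)
  also have "(\<Sum>k = 1..(m - 1) div 2.
      \<beta> k * (\<Sum>l<m. cos (2 * pi * real k * (real l - of_int y) / real m))) = 0"
    by (intro sum.neutral ballI) (use sum_cos_full_period in auto)
  finally show ?thesis by simp
qed

text \<open>The product form avoids dividing by \<open>sin (x / 2)\<close>; each new term telescopes
  by the addition formulas.\<close>

lemma dirichlet_kernel:
  fixes x :: real
  shows "sin (x / 2) * (1 + 2 * (\<Sum>k = 1..K. cos (real k * x))) = sin ((real K + 1 / 2) * x)"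
proof (induction K)
  case (Suc K)
  have "sin (x / 2) * (1 + 2 * (\<Sum>k = 1..Suc K. cos (real k * x)))
    = sin ((real K + 1 / 2) * x) + 2 * sin (x / 2) * cos (real (Suc K) * x)"
    using Suc by (simp add: algebra_simps)
  also have "(real K + 1 / 2) * x = real (Suc K) * x - x / 2" by (simp add: algebra_simps)
  also have "sin (real (Suc K) * x - x / 2) + 2 * sin (x / 2) * cos (real (Suc K) * x)
    = sin (real (Suc K) * x + x / 2)" unfolding sin_add sin_diff by (simp add: algebra_simps)
  also have "real (Suc K) * x + x / 2 = (real (Suc K) + 1 / 2) * x" by (simp add: algebra_simps)
  finally show ?case .
qed simp

text \<open>Fourier expansion of the identity matrix: the bound on \<open>x\<close> covers all
  differences of two indices, and off zero the Dirichlet kernel vanishes at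
  \<open>2 * pi * x / m\<close>.\<close>

lemma cos_series_delta:
  assumes "odd m" "\<bar>x\<bar> < int m"
  shows "cos_series m (1 / real m) (\<lambda>_. 2 / real m) x = of_bool (x = 0)"
proof (cases "x = 0")
  case True
  have "real ((m - 1) div 2) = (real m - 1) / 2" using assms(1) by (auto elim!: oddE)
  then show ?thesis using True assms by (simp add: cos_series_def field_simps)
next
  case False
  define t where "t = 2 * pi * of_int x / real m"
  have m: "real m > 0" using assms by auto
  have "sin (t / 2) \<noteq> 0"
  proof
    assume "sin (t / 2) = 0"
    then obtain i where "t / 2 = of_int i * pi" by (auto simp: sin_zero_iff_int2)
    then have "of_int x = (of_int (i * int m) :: real)" using m by (simp add: t_def field_simps)
    then have "x = i * int m" by linarith
    then have "int m dvd x" by simp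
    then show False using assms(2) False zdvd_not_zless[of "\<bar>x\<bar>" "int m"] by simp
  qed
  \<comment> \<open>For odd \<open>m\<close> the factor is \<open>m / 2\<close>, so the sine in
    \<open>dirichlet_kernel\<close> is taken at an integer multiple of \<open>pi\<close>.\<close>
  moreover have "(real ((m - 1) div 2) + 1 / 2) * t = of_int x * pi"
    using assms(1) m by (auto elim!: oddE simp: t_def field_simps)
  then have "sin (t / 2) * (1 + 2 * (\<Sum>k = 1..(m - 1) div 2. cos (real k * t))) = 0"
    unfolding dirichlet_kernel by (simp add: sin_zero_iff_int2)
  ultimately have "1 + 2 * (\<Sum>k = 1..(m - 1) div 2. cos (real k * t)) = 0" by simp
  then have "(1 / real m) * (1 + 2 * (\<Sum>k = 1..(m - 1) div 2. cos (real k * t))) = 0" by simp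
  then show ?thesis using False
    by (simp add: cos_series_def t_def sum_distrib_left algebra_simps)
qed

text \<open>Adding both neighbours scales mode \<open>k\<close> by
  \<open>2 * cos (2 * pi * k / m)\<close>. The projection affects the constant mode alone, where
  \<open>5 - 9 * m / (2 * m + 1)\<close> is left. The result is again a cosine series, so the lemma
  can be iterated.\<close>

lemma gram_mult_cos_series:
  assumes "m > 0"
  shows "(proj_inc_mat m)\<^sup>T * proj_inc_mat m * circ_mat m (cos_series m \<alpha> \<beta>)
    = circ_mat m (cos_series m ((real m + 5) / (2 * real m + 1) * \<alpha>)
        (\<lambda>k. (3 + 2 * cos (2 * pi * real k / real m)) * \<beta> k))"
proof -
  have cos: "3 * cos (2 * pi * real k * of_int x / real m) + cos (2 * pi * real k * of_int (x + 1) / real m)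
      + cos (2 * pi * real k * of_int (x - 1) / real m)
    = (3 + 2 * cos (2 * pi * real k / real m)) * cos (2 * pi * real k * of_int x / real m)" for k x
  proof -
    have "2 * pi * real k * of_int (x + 1) / real m
        = 2 * pi * real k * of_int x / real m + 2 * pi * real k / real m"
      "2 * pi * real k * of_int (x - 1) / real m
        = 2 * pi * real k * of_int x / real m - 2 * pi * real k / real m"
      by (simp_all add: algebra_simps add_divide_distrib diff_divide_distrib)
    then show ?thesis by (simp only: cos_add cos_diff) (simp add: algebra_simps)
  qed
  have const: "5 * \<alpha> - 9 * (real m * \<alpha>) / (2 * real m + 1) = (real m + 5) / (2 * real m + 1) * \<alpha>"
    by (simp add: field_simps)
  have "3 * cos_series m \<alpha> \<beta> x + cos_series m \<alpha> \<beta> (x + 1) + cos_series m \<alpha> \<beta> (x - 1)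
      - 9 * (real m * \<alpha>) / (2 * real m + 1)
    = (5 * \<alpha> - 9 * (real m * \<alpha>) / (2 * real m + 1)) + (\<Sum>k = 1..(m - 1) div 2. \<beta> k *
        (3 * cos (2 * pi * real k * of_int x / real m) + cos (2 * pi * real k * of_int (x + 1) / real m)
          + cos (2 * pi * real k * of_int (x - 1) / real m)))" for x
    unfolding cos_series_def by (simp only: distrib_left sum.distrib sum_distrib_left) (simp add: mult.left_commute)
  then have "3 * cos_series m \<alpha> \<beta> x + cos_series m \<alpha> \<beta> (x + 1) + cos_series m \<alpha> \<beta> (x - 1)
      - 9 * (real m * \<alpha>) / (2 * real m + 1)
    = cos_series m ((real m + 5) / (2 * real m + 1) * \<alpha>)
        (\<lambda>k. (3 + 2 * cos (2 * pi * real k / real m)) * \<beta> k) x" for x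
    unfolding cos const by (simp add: cos_series_def mult.commute mult.left_commute)
  then show ?thesis
    using gram_mult_circ[OF assms periodic_cos_series[OF assms] sum_cos_series, of \<alpha> \<beta>] by simp
qed


section \<open>Entries of block matrices, circulants and \<open>D\<close>\<close>

lemma three_block_mat_dim:
  assumes "M11 \<in> carrier_mat 1 1" "M22 \<in> carrier_mat m m" "M33 \<in> carrier_mat m m"
  shows "three_block_mat M11 M12 M13 M21 M22 M23 M31 M32 M33 \<in> carrier_mat (2 * m + 1) (2 * m + 1)"
  using assms by (auto simp: three_block_mat_def)

lemma three_block_mat_index:
  assumes "M11 \<in> carrier_mat 1 1" "M12 \<in> carrier_mat 1 m" "M13 \<in> carrier_mat 1 m"
    "M21 \<in> carrier_mat m 1" "M22 \<in> carrier_mat m m" "M23 \<in> carrier_mat m m"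
    "M31 \<in> carrier_mat m 1" "M32 \<in> carrier_mat m m" "M33 \<in> carrier_mat m m"
    and "p < 2 * m + 1" "q < 2 * m + 1"
  shows "three_block_mat M11 M12 M13 M21 M22 M23 M31 M32 M33 $$ (p, q) =
    (if p = 0 then
       if q = 0 then M11 $$ (0, 0) else if q \<le> m then M12 $$ (0, q - 1) else M13 $$ (0, q - 1 - m)
     else if p \<le> m then
       if q = 0 then M21 $$ (p - 1, 0) else if q \<le> m then M22 $$ (p - 1, q - 1)
       else M23 $$ (p - 1, q - 1 - m)
     else
       if q = 0 then M31 $$ (p - 1 - m, 0) else if q \<le> m then M32 $$ (p - 1 - m, q - 1)
       else M33 $$ (p - 1 - m, q - 1 - m))"
  using assms by (auto simp: three_block_mat_def append_rows_def not_le less_Suc_eq_le)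

text \<open>Reading the first row as values of a periodic function removes the \<open>mod\<close>
  and the summand \<open>p\<close> from the definition of \<open>Circ\<close>.\<close>

lemma Circ_index:
  assumes "length as = m" "periodic m g" "\<And>d. d < m \<Longrightarrow> as ! d = g (int d)" "i < m" "j < m"
  shows "Circ as $$ (i, j) = g (int j - int i)"
proof -
  let ?d = "(j + m - i) mod m"
  have "Circ as $$ (i, j) = as ! ?d" using assms by (simp add: Circ_def)
  also have "\<dots> = g (int ?d)" using assms by simp
  also have "\<dots> = g (int j - int i)"
  proof (rule periodicD[OF assms(2)])
    have "int ?d = (int j - int i + int m) mod int m" using assms(4) by (simp add: zmod_int of_nat_diff algebra_simps)
    then show "int m dvd int ?d - (int j - int i)"
      unfolding mod_eq_dvd_iff[symmetric] by simp
  qed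
  finally show ?thesis .
qed

text \<open>Wide enough for differences of indices and for an index shifted by one in either
  direction; the only multiples of \<open>m\<close> in the range are \<open>0\<close> and
  \<open>m\<close>.\<close>

lemma delta_mod_small:
  assumes "- int m < x" "x < 2 * int m"
  shows "delta_mod m x = of_bool (x = 0 \<or> x = int m)"
proof -
  have "x = 0 \<or> x = int m" if dv: "int m dvd x"
  proof -
    obtain c where c: "x = int m * c" using dv by (rule dvdE)
    have m: "0 < int m" using assms by linarith
    have "int m * (-1) < int m * c" "int m * c < int m * 2" using assms c by linarith+
    then have "- 1 < c" "c < 2" using m by (simp_all only: mult_less_cancel_left_pos)
    then have "c = 0 \<or> c = 1" by auto
    then show ?thesis using c by auto
  qed
  then show ?thesis by (auto simp: delta_mod_def)
qed

text \<open>The two ones of the first row sit at \<open>0\<close> and at \<open>m - 1\<close>, which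
  is congruent to \<open>-1\<close>. The constant is \<open>1 + 2\<close>, the sum of the distances
  to the hub, as the decomposition of \<open>D\<close> requires.\<close>

lemma gear_S_index:
  assumes "m \<ge> 3" "i < m" "j < m"
  shows "gear_S (Suc m) $$ (i, j) = 3 - 2 * (delta_mod m (int j - int i) + delta_mod m (int j - int i + 1))"
  unfolding gear_S_def
proof (rule Circ_index[where g = "\<lambda>x. 3 - 2 * (delta_mod m x + delta_mod m (x + 1))"])
  have "delta_mod m (x + int m + c) = delta_mod m (x + c)" for x c
    by (rule periodicD[OF periodic_delta_mod]) simp
  from this[of _ 0] this[of _ 1]
  show "periodic m (\<lambda>x. 3 - 2 * (delta_mod m x + delta_mod m (x + 1)))"
    by (intro periodicI) simp
  show "([1] @ replicate (Suc m - 3) 3 @ [1]) ! d = 3 - 2 * (delta_mod m (int d) + delta_mod m (int d + 1))"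
    if "d < m" for d
    using that assms by (auto simp: delta_mod_small nth_append nth_Cons split: nat.splits)
qed (use assms in auto)

text \<open>The bracket is the inner product of two rows of \<open>V\<close> in the second ring, and
  \<open>4\<close> is \<open>2 + 2\<close>.\<close>

lemma gear_T_index:
  assumes "m \<ge> 3" "i < m" "j < m"
  shows "gear_T (Suc m) $$ (i, j) = 4 - 2 * (2 * delta_mod m (int j - int i)
    + delta_mod m (int j - int i + 1) + delta_mod m (int j - int i - 1))"
  unfolding gear_T_def
proof (rule Circ_index[where g = "\<lambda>x. 4 - 2 * (2 * delta_mod m x + delta_mod m (x + 1) + delta_mod m (x - 1))"])
  have "delta_mod m (x + int m + c) = delta_mod m (x + c)" for x c
    by (rule periodicD[OF periodic_delta_mod]) simp
  from this[of _ 0] this[of _ 1] this[of _ "-1"]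
  show "periodic m (\<lambda>x. 4 - 2 * (2 * delta_mod m x + delta_mod m (x + 1) + delta_mod m (x - 1)))"
    by (intro periodicI) simp
  show "([0, 2] @ replicate (Suc m - 4) 4 @ [2]) ! d
      = 4 - 2 * (2 * delta_mod m (int d) + delta_mod m (int d + 1) + delta_mod m (int d - 1))"
    if "d < m" for d
    using that assms by (auto simp: delta_mod_small nth_append nth_Cons split: nat.splits)
qed (use assms in auto)

lemma gear_S_carrier: "m \<ge> 3 \<Longrightarrow> gear_S (Suc m) \<in> carrier_mat m m"
  and gear_T_carrier: "m \<ge> 3 \<Longrightarrow> gear_T (Suc m) \<in> carrier_mat m m"
  and gear_C_carrier: "m \<ge> 3 \<Longrightarrow> gear_C (Suc m) k \<in> carrier_mat m m"
  and gear_C_tilde_carrier: "m \<ge> 3 \<Longrightarrow> gear_C_tilde (Suc m) k \<in> carrier_mat m m"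
  by (auto simp: gear_S_def gear_T_def gear_C_def gear_C_tilde_def Circ_def Let_def)

lemma ones_col_carrier: "ones_col m \<in> carrier_mat m 1"
  and J_mat_carrier: "J_mat m \<in> carrier_mat m m"
  by (auto simp: ones_col_def J_mat_def)

lemma ones_col_index: "i < m \<Longrightarrow> ones_col m $$ (i, 0) = 1"
  by (simp add: ones_col_def)

lemma J_mat_index: "i < m \<Longrightarrow> j < m \<Longrightarrow> J_mat m $$ (i, j) = 1"
  by (simp add: ones_col_def J_mat_def scalar_prod_def)

lemma gear_D_carrier: "m \<ge> 3 \<Longrightarrow> gear_D (Suc m) \<in> carrier_mat (2 * m + 1) (2 * m + 1)"
  unfolding gear_D_def
  by (rule three_block_mat_dim) (use J_mat_carrier[of m] gear_T_carrier[of m] in auto)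

text \<open>Entrywise form of the decomposition of \<open>D\<close>; \<open>inc_row\<close> of the
  constant \<open>1\<close> is the distance to the hub, \<open>0\<close>, \<open>1\<close> or
  \<open>2\<close>.\<close>

lemma gear_D_index:
  assumes "m \<ge> 3" "p < 2 * m + 1" "q < 2 * m + 1"
  shows "gear_D (Suc m) $$ (p, q) = inc_row m p (\<lambda>_. 1) + inc_row m q (\<lambda>_. 1)
    - 2 * inc_row m q (\<lambda>y. inc_row m p (\<lambda>x. delta_mod m (x - y)))"
proof -
  \<comment> \<open>These instances fix one orientation for the differences that the case analysis
    produces.\<close>
  have sym: "delta_mod m (int p - int q) = delta_mod m (int q - int p)"
    "delta_mod m (int p - (1 + int q)) = delta_mod m (1 + int q - int p)"
    "delta_mod m (1 + int p - int q) = delta_mod m (int q - (1 + int p))"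
    "delta_mod m (int m + int p - int q) = delta_mod m (int q - (int m + int p))"
    "delta_mod m (int m + int p - (1 + int q)) = delta_mod m (1 + int q - (int m + int p))"
    by (rule delta_mod_commute)+
  note carriers = ones_col_carrier[of m] J_mat_carrier[of m] gear_S_carrier[OF assms(1)] gear_T_carrier[OF assms(1)]
  have D: "gear_D (Suc m) $$ (p, q) =
    (if p = 0 then
       if q = 0 then 0 else if q \<le> m then 1 else 2
     else if p \<le> m then
       if q = 0 then 1 else if q \<le> m then 2 * (1 - of_bool (p = q))
       else gear_S (Suc m) $$ (p - 1, q - 1 - m)
     else
       if q = 0 then 2 else if q \<le> m then gear_S (Suc m) $$ (q - 1, p - 1 - m)
       else gear_T (Suc m) $$ (p - 1 - m, q - 1 - m))"
    unfolding gear_D_def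
    by (subst three_block_mat_index[where m = m])
      (use carriers assms in \<open>auto simp: ones_col_index J_mat_index\<close>)
  \<comment> \<open>Within the first ring index differences stay strictly between \<open>-m\<close>
    and \<open>m\<close>, so congruence is equality.\<close>
  have diag: "delta_mod m (int q - int p) = of_bool (p = q)" if "0 < p" "p \<le> m" "0 < q" "q \<le> m"
    using that by (subst delta_mod_small) auto
  show ?thesis
    unfolding D
    using assms diag
    by (auto simp: inc_row_def gear_S_index gear_T_index of_nat_diff algebra_simps sym)
qed


section \<open>Factorization of \<open>U\<close>\<close>

text \<open>The identity is the circulant with symbol \<open>delta_mod m\<close>, so this is a case
  of \<open>inc_mat_circ_inc_index\<close>.\<close>

lemma inc_mat_gram_index:
  assumes "m > 0" "p < 2 * m + 1" "q < 2 * m + 1"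
  shows "(inc_mat m * (inc_mat m)\<^sup>T) $$ (p, q) = inc_row m q (\<lambda>y. inc_row m p (\<lambda>x. delta_mod m (x - y)))"
proof -
  have "circ_mat m (delta_mod m) = 1\<^sub>m m"
    by (rule eq_matI) (auto simp: circ_mat_def delta_mod_small)
  then show ?thesis
    using inc_mat_circ_inc_index[OF assms(1) periodic_delta_mod assms(2,3)]
      right_mult_one_mat[OF inc_mat_carrier] by simp
qed

lemma gear_gram:
  assumes "m \<ge> 3" and P_def: "P = 1\<^sub>m (2 * m + 1) - (1 / real (2 * m + 1)) \<cdot>\<^sub>m J_mat (2 * m + 1)"
  shows "(- (1 / 2)) \<cdot>\<^sub>m (P * gear_D (Suc m) * P) = proj_inc_mat m * (proj_inc_mat m)\<^sup>T"
proof -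
  let ?M = "2 * m + 1"
  define V e a where "V = inc_mat m" and "e = ones_col ?M"
    and "a = mat ?M 1 (\<lambda>(p, _). inc_row m p (\<lambda>_. 1))"
  have m: "m > 0" using assms by simp
  have V: "V \<in> carrier_mat ?M m" and e: "e \<in> carrier_mat ?M 1" and a: "a \<in> carrier_mat ?M 1"
    and Vt: "V\<^sup>T \<in> carrier_mat m ?M" and et: "e\<^sup>T \<in> carrier_mat 1 ?M" and at: "a\<^sup>T \<in> carrier_mat 1 ?M"
    and P: "P \<in> carrier_mat ?M ?M"
    using inc_mat_carrier[of m] ones_col_carrier[of ?M] J_mat_carrier[of ?M]
    by (auto simp: V_def e_def a_def P_def)
  have ea: "e * a\<^sup>T \<in> carrier_mat ?M ?M" and ae: "a * e\<^sup>T \<in> carrier_mat ?M ?M"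
    and VV: "V * V\<^sup>T \<in> carrier_mat ?M ?M"
    using V e a by auto
  have P_index: "P $$ (p, r) = of_bool (p = r) - 1 / (2 * real m + 1)" if "p < ?M" "r < ?M" for p r
    using that J_mat_carrier[of ?M] by (auto simp: P_def J_mat_index)
  \<comment> \<open>\<open>P\<close> subtracts the mean; this yields both \<open>P * e\<close> and
    \<open>P * V\<close>.\<close>
  have P_sum: "(\<Sum>r<?M. P $$ (p, r) * g r) = g p - (\<Sum>r<?M. g r) / (2 * real m + 1)" if "p < ?M" for p g
  proof -
    have "(\<Sum>r<?M. P $$ (p, r) * g r) = (\<Sum>r<?M. (if r = p then g r else 0) - g r / (2 * real m + 1))"
      using that by (intro sum.cong refl) (auto simp: P_index left_diff_distrib)
    also have "\<dots> = g p - (\<Sum>r<?M. g r) / (2 * real m + 1)"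
      using that by (simp only: sum_subtractf sum_divide_distrib sum.delta finite_lessThan lessThan_iff) simp
    finally show ?thesis .
  qed
  have Pt: "P\<^sup>T = P"
    using P by (intro eq_matI) (auto simp: P_index)
  have Pe: "P * e = 0\<^sub>m ?M 1"
  proof (rule eq_matI)
    fix p j assume "p < dim_row (0\<^sub>m ?M 1 :: real mat)" "j < dim_col (0\<^sub>m ?M 1 :: real mat)"
    then have pj: "p < ?M" "j < 1" by auto
    have "(P * e) $$ (p, j) = (\<Sum>r<?M. P $$ (p, r) * 1)"
      unfolding index_mult_mat_sum[OF P e pj]
      by (intro sum.cong refl) (use pj in \<open>simp add: e_def ones_col_def\<close>)
    also have "\<dots> = 0" unfolding P_sum[OF pj(1)] by (simp add: field_simps)
    finally show "(P * e) $$ (p, j) = 0\<^sub>m ?M 1 $$ (p, j)" using pj by simp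
  qed (use P e in auto)
  have PV: "P * V = proj_inc_mat m"
  proof (rule eq_matI)
    fix p j assume "p < dim_row (proj_inc_mat m)" "j < dim_col (proj_inc_mat m)"
    then have pj: "p < ?M" "j < m" using proj_inc_mat_carrier[of m] by auto
    have "(P * V) $$ (p, j) = (\<Sum>r<?M. P $$ (p, r) * inc_row m r (\<lambda>x. delta_mod m (x - int j)))"
      unfolding index_mult_mat_sum[OF P V pj]
      by (intro sum.cong refl) (use pj in \<open>simp add: V_def inc_mat_def\<close>)
    also have "\<dots> = proj_inc_mat m $$ (p, j)"
      unfolding P_sum[OF pj(1)] sum_inc_row_delta_col[OF m] using pj by (simp add: proj_inc_mat_def)
    finally show "(P * V) $$ (p, j) = proj_inc_mat m $$ (p, j)" .
  qed (use P V proj_inc_mat_carrier[of m] in auto)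
  have D: "gear_D (Suc m) = (e * a\<^sup>T + a * e\<^sup>T) + (- 2) \<cdot>\<^sub>m (V * V\<^sup>T)"
  proof (rule eq_matI)
    fix p q
    assume "p < dim_row ((e * a\<^sup>T + a * e\<^sup>T) + (- 2) \<cdot>\<^sub>m (V * V\<^sup>T))"
      "q < dim_col ((e * a\<^sup>T + a * e\<^sup>T) + (- 2) \<cdot>\<^sub>m (V * V\<^sup>T))"
    then have pq: "p < ?M" "q < ?M" using V by auto
    have "(e * a\<^sup>T) $$ (p, q) = inc_row m q (\<lambda>_. 1)" "(a * e\<^sup>T) $$ (p, q) = inc_row m p (\<lambda>_. 1)"
      unfolding index_mult_mat_sum[OF e at pq] index_mult_mat_sum[OF a et pq]
      using pq by (simp_all add: e_def a_def ones_col_def)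
    moreover have "(V * V\<^sup>T) $$ (p, q) = inc_row m q (\<lambda>y. inc_row m p (\<lambda>x. delta_mod m (x - y)))"
      unfolding V_def by (rule inc_mat_gram_index[OF m pq])
    moreover have "((e * a\<^sup>T + a * e\<^sup>T) + (- 2) \<cdot>\<^sub>m (V * V\<^sup>T)) $$ (p, q)
      = (e * a\<^sup>T) $$ (p, q) + (a * e\<^sup>T) $$ (p, q) - 2 * (V * V\<^sup>T) $$ (p, q)"
      using pq V e a by (simp del: index_mult_mat(1))
    ultimately show "gear_D (Suc m) $$ (p, q) = ((e * a\<^sup>T + a * e\<^sup>T) + (- 2) \<cdot>\<^sub>m (V * V\<^sup>T)) $$ (p, q)"
      using gear_D_index[OF assms(1) pq] by simp
  qed (use V gear_D_carrier[OF assms(1)] in auto)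
  have PeaP: "P * (e * a\<^sup>T) * P = 0\<^sub>m ?M ?M"
  proof -
    have "P * (e * a\<^sup>T) = 0\<^sub>m ?M 1 * a\<^sup>T" using assoc_mult_mat[OF P e at] Pe by simp
    then show ?thesis using at P by simp
  qed
  \<comment> \<open>By symmetry of \<open>P\<close>, \<open>Pe\<close> also annihilates the row
    vector from the right.\<close>
  have PaeP: "P * (a * e\<^sup>T) * P = 0\<^sub>m ?M ?M"
  proof -
    have "e\<^sup>T * P = (P * e)\<^sup>T" using transpose_mult[OF P e] Pt by simp
    then have "e\<^sup>T * P = 0\<^sub>m 1 ?M" by (simp add: Pe)
    moreover have "P * (a * e\<^sup>T) * P = P * (a * (e\<^sup>T * P))"
      using assoc_mult_mat[OF P ae P] assoc_mult_mat[OF a et P] by simp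
    ultimately show ?thesis using a P by simp
  qed
  have PVVP: "P * (V * V\<^sup>T) * P = proj_inc_mat m * (proj_inc_mat m)\<^sup>T"
  proof -
    have "(proj_inc_mat m)\<^sup>T = V\<^sup>T * P" using transpose_mult[OF P V] Pt by (simp add: PV)
    moreover have PV': "P * V \<in> carrier_mat ?M m" using P V by auto
    moreover have "P * (V * V\<^sup>T) * P = (P * V) * (V\<^sup>T * P)"
      using assoc_mult_mat[OF P V Vt] assoc_mult_mat[OF PV' Vt P] by simp
    ultimately show ?thesis by (simp add: PV)
  qed
  have sm: "(- 2) \<cdot>\<^sub>m (V * V\<^sup>T) \<in> carrier_mat ?M ?M" using VV by auto
  have "P * gear_D (Suc m) = (P * (e * a\<^sup>T) + P * (a * e\<^sup>T)) + (- 2) \<cdot>\<^sub>m (P * (V * V\<^sup>T))"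
    unfolding D mult_add_distrib_mat[OF P add_carrier_mat[OF ae] sm] mult_add_distrib_mat[OF P ea ae]
      mult_smult_distrib[OF P VV] ..
  also have "\<dots> * P = (P * (e * a\<^sup>T) * P + P * (a * e\<^sup>T) * P) + (- 2) \<cdot>\<^sub>m (P * (V * V\<^sup>T) * P)"
  proof -
    have 1: "P * (e * a\<^sup>T) \<in> carrier_mat ?M ?M" and 2: "P * (a * e\<^sup>T) \<in> carrier_mat ?M ?M"
      and 3: "P * (V * V\<^sup>T) \<in> carrier_mat ?M ?M" using P ea ae VV by auto
    show ?thesis
      unfolding add_mult_distrib_mat[OF add_carrier_mat[OF 2] smult_carrier_mat[OF 3] P]
        add_mult_distrib_mat[OF 1 2 P] mult_smult_assoc_mat[OF 3 P] ..
  qed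
  finally have "P * gear_D (Suc m) * P = (- 2) \<cdot>\<^sub>m (proj_inc_mat m * (proj_inc_mat m)\<^sup>T)"
    unfolding PeaP PaeP PVVP using proj_inc_mat_carrier[of m] by (simp add: left_add_zero_mat)
  then show ?thesis using proj_inc_mat_carrier[of m] by (auto intro!: eq_matI)
qed

section \<open>Entries of \<open>A\<close>, of \<open>B_k\<close> and of their sum\<close>

text \<open>Both claims go through one induction, since adding entrywise needs the dimensions of the
  partial sum.\<close>

lemma index_finsum_mat:
  assumes "finite S" "\<And>k. k \<in> S \<Longrightarrow> B k \<in> carrier_mat r c"
  shows "finsum (module_mat TYPE(real) r c) B S \<in> carrier_mat r c \<and>
    (\<forall>p<r. \<forall>q<c. finsum (module_mat TYPE(real) r c) B S $$ (p, q) = (\<Sum>k\<in>S. B k $$ (p, q)))"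
  using assms
proof (induction S rule: finite_induct)
  case empty
  interpret abelian_group "module_mat TYPE(real) r c" by (rule abelian_group_mat)
  show ?case using finsum_empty by (simp add: module_mat_simps)
next
  case (insert k S)
  interpret abelian_group "module_mat TYPE(real) r c" by (rule abelian_group_mat)
  have "finsum (module_mat TYPE(real) r c) B (insert k S) = B k + finsum (module_mat TYPE(real) r c) B S"
    using finsum_insert[OF insert(1,2), of B] insert(4) by (auto simp: module_mat_simps)
  then show ?case using insert by auto
qed

lemma gear_C_index:
  assumes "m \<ge> 3" "i < m" "j < m"
  shows "gear_C (Suc m) k $$ (i, j) = cos (2 * pi * real k * of_int (int j - int i) / real m)"
  unfolding gear_C_def
proof (rule Circ_index[OF _ periodic_cos])
  fix d assume "d < m"
  then show "([1] @ map (\<lambda>j. cos (2 * pi * real j * real k / (real (Suc m) - 1))) [1..<Suc m - 1]) ! d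
    = cos (2 * pi * real k * of_int (int d) / real m)"
    by (cases d) (auto simp: mult_ac)
qed (use assms in auto)

text \<open>The first row is that of \<open>gear_C\<close> moved one place to the left; its last
  entry \<open>1\<close> is the cosine of \<open>k\<close> full turns.\<close>

lemma gear_C_tilde_index:
  assumes "m \<ge> 3" "i < m" "j < m"
  shows "gear_C_tilde (Suc m) k $$ (i, j) = cos (2 * pi * real k * of_int (int j - int i + 1) / real m)"
  unfolding gear_C_tilde_def
proof (rule Circ_index[where g = "\<lambda>x. cos (2 * pi * real k * of_int (x + 1) / real m)"])
  have m: "m > 0" using assms by simp
  show "periodic m (\<lambda>x. cos (2 * pi * real k * of_int (x + 1) / real m))"
    using periodic_shift[OF periodic_cos[OF m], of k 1] .
  fix d assume "d < m"
  show "(map (\<lambda>j. cos (2 * pi * real j * real k / (real (Suc m) - 1))) [1..<Suc m - 1] @ [1]) ! d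
    = cos (2 * pi * real k * of_int (int d + 1) / real m)"
  proof (cases "d = m - 1")
    case True
    then have "2 * pi * real k * of_int (int d + 1) / real m = 2 * pi * of_int (int k)"
      using m by (simp add: of_nat_diff)
    then have "cos (2 * pi * real k * of_int (int d + 1) / real m) = 1"
      by (simp only: cos_int_2pin)
    then show ?thesis using True m by (simp add: nth_append)
  next
    case False
    then show ?thesis using \<open>d < m\<close> by (auto simp: nth_append algebra_simps)
  qed
qed (use assms in auto)

lemma gear_A_carrier: "gear_A (Suc m) \<in> carrier_mat (2 * m + 1) (2 * m + 1)"
  unfolding gear_A_def Let_def
  by (intro smult_carrier_mat three_block_mat_dim) (use J_mat_carrier[of m] in auto)

text \<open>\<open>A\<close> has rank one. Its generating vector \<open>w\<close> is a negative
  multiple of \<open>Pa\<close>, the hub distances minus their mean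
  \<open>3 * m / (2 * m + 1)\<close>.\<close>

lemma gear_A_index:
  assumes "m \<ge> 3" "p < 2 * m + 1" "q < 2 * m + 1"
  shows "gear_A (Suc m) $$ (p, q) = (2 * real m + 1)\<^sup>2 / (real m * (real m + 5)\<^sup>2)
    * (inc_row m p (\<lambda>_. 1) - 3 * real m / (2 * real m + 1))
    * (inc_row m q (\<lambda>_. 1) - 3 * real m / (2 * real m + 1))"
proof -
  define w :: "nat \<Rightarrow> real" where
    "w p = (if p = 0 then 1 else if p \<le> m then (real m - 1) / (3 * real m) else - (real m + 2) / (3 * real m))" for p
  note carriers = ones_col_carrier[of m] J_mat_carrier[of m]
  define T where "T = three_block_mat
       (1\<^sub>m 1)
       (((real (Suc m) - 2) / (3 * (real (Suc m) - 1))) \<cdot>\<^sub>m (ones_col m)\<^sup>T)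
       ((- (real (Suc m) + 1) / (3 * (real (Suc m) - 1))) \<cdot>\<^sub>m (ones_col m)\<^sup>T)
       (((real (Suc m) - 2) / (3 * (real (Suc m) - 1))) \<cdot>\<^sub>m ones_col m)
       (((real (Suc m) - 2)\<^sup>2 / (9 * (real (Suc m) - 1)\<^sup>2)) \<cdot>\<^sub>m J_mat m)
       ((- (real (Suc m) - 2) * (real (Suc m) + 1) / (9 * (real (Suc m) - 1)\<^sup>2)) \<cdot>\<^sub>m J_mat m)
       ((- (real (Suc m) + 1) / (3 * (real (Suc m) - 1))) \<cdot>\<^sub>m ones_col m)
       ((- (real (Suc m) - 2) * (real (Suc m) + 1) / (9 * (real (Suc m) - 1)\<^sup>2)) \<cdot>\<^sub>m J_mat m)
       (((real (Suc m) + 1)\<^sup>2 / (9 * (real (Suc m) - 1)\<^sup>2)) \<cdot>\<^sub>m J_mat m)"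
  have T: "T \<in> carrier_mat (2 * m + 1) (2 * m + 1)"
    unfolding T_def by (rule three_block_mat_dim) (use carriers in auto)
  have T_index: "T $$ (p, q) = w p * w q"
    unfolding T_def
    by (subst three_block_mat_index[where m = m])
      (use carriers assms in \<open>auto simp: ones_col_index J_mat_index w_def power2_eq_square field_simps\<close>)
  have "gear_A (Suc m) = (9 * real m / (real m + 5)\<^sup>2) \<cdot>\<^sub>m T"
    unfolding gear_A_def Let_def T_def by (simp add: add.commute)
  then have A: "gear_A (Suc m) $$ (p, q) = 9 * real m / (real m + 5)\<^sup>2 * (w p * w q)"
    using T assms T_index by simp
  have w: "inc_row m p (\<lambda>_. 1) - 3 * real m / (2 * real m + 1) = - (3 * real m / (2 * real m + 1)) * w p" for p
    using assms(1) by (simp add: w_def inc_row_def field_simps)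
  have "2 * real m + 1 \<noteq> 0" "real m \<noteq> 0" using assms(1) by linarith+
  then show ?thesis unfolding A w
    by (simp add: divide_simps) (simp add: power2_eq_square)
qed

lemma gear_B_carrier:
  assumes "m \<ge> 3"
  shows "gear_B (Suc m) k \<in> carrier_mat (2 * m + 1) (2 * m + 1)"
  unfolding gear_B_def Let_def
  by (intro smult_carrier_mat three_block_mat_dim) (use gear_C_carrier[OF assms] in auto)

text \<open>\<open>B_k\<close> is a multiple of \<open>V C_k V'\<close>. Two rows of the second ring
  give \<open>2 * c x + c (x + 1) + c (x - 1)\<close>, which is
  \<open>4 * \<phi>\<^sup>2 * c x\<close>; this explains why the other nonzero blocks are divided by
  \<open>4 * \<phi>\<^sup>2\<close>.\<close>

lemma gear_B_index:
  assumes "m \<ge> 3" "2 * k < m" and pq: "p < 2 * m + 1" "q < 2 * m + 1"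
  shows "gear_B (Suc m) k $$ (p, q) = 2 / (real m * (3 + 2 * cos (2 * pi * real k / real m))\<^sup>2)
    * inc_row m q (\<lambda>y. inc_row m p (\<lambda>x. cos (2 * pi * real k * of_int (x - y) / real m)))"
proof -
  define \<phi> where "\<phi> = cos (pi * real k / real m)"
  define c where "c x = cos (2 * pi * real k * of_int x / real m)" for x
  \<comment> \<open>\<open>2 * k < m\<close> keeps the angle below a right angle, so
    \<open>\<phi>\<close> may be divided by.\<close>
  have "pi * real k / real m < pi / 2" using assms by (simp add: field_simps)
  then have \<phi>: "\<phi> > 0" unfolding \<phi>_def by (intro cos_gt_zero_pi) (auto intro: less_le_trans[of _ 0])
  have double: "cos (2 * pi * real k / real m) = 2 * \<phi>\<^sup>2 - 1"
    using cos_double_cos[of "pi * real k / real m"] by (simp add: \<phi>_def mult.assoc)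
  have neg: "c (- x) = c x" for x by (simp add: c_def)
  have neighbours: "c (x + 1) + c (x - 1) = (4 * \<phi>\<^sup>2 - 2) * c x" for x
  proof -
    have "2 * pi * real k * of_int (x + 1) / real m
        = 2 * pi * real k * of_int x / real m + 2 * pi * real k / real m"
      "2 * pi * real k * of_int (x - 1) / real m
        = 2 * pi * real k * of_int x / real m - 2 * pi * real k / real m"
      by (simp_all add: algebra_simps add_divide_distrib diff_divide_distrib)
    then show ?thesis unfolding c_def by (simp only: cos_add cos_diff double) (simp add: algebra_simps)
  qed
  define F where "F = 2 / (real m * (2 * \<phi> + 1 / (2 * \<phi>))\<^sup>2)"
  define b where "b = 2 / (real m * (3 + 2 * cos (2 * pi * real k / real m))\<^sup>2)"
  \<comment> \<open>The eigenvalue \<open>3 + 2 * cos (2 * pi * k / m)\<close> is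
    \<open>4 * \<phi>\<^sup>2 + 1\<close>, that is, \<open>2 * \<phi>\<close> times the bracket in
    the scalar of \<open>gear_B\<close>.\<close>
  have F: "F = b * (4 * \<phi>\<^sup>2)"
  proof -
    have "2 * \<phi> + 1 / (2 * \<phi>) = (4 * \<phi>\<^sup>2 + 1) / (2 * \<phi>)"
      using \<phi> by (simp add: field_simps power2_eq_square)
    then show ?thesis unfolding F_def b_def double
      using \<phi> by (simp add: power_divide power_mult_distrib add.commute)
  qed
  define T where "T = three_block_mat (0\<^sub>m 1 1) (0\<^sub>m 1 m) (0\<^sub>m 1 m)
       (0\<^sub>m m 1) ((1 / (4 * \<phi>\<^sup>2)) \<cdot>\<^sub>m gear_C (Suc m) k)
       ((1 / (4 * \<phi>\<^sup>2)) \<cdot>\<^sub>m (gear_C (Suc m) k + gear_C_tilde (Suc m) k))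
       (0\<^sub>m m 1) ((1 / (4 * \<phi>\<^sup>2)) \<cdot>\<^sub>m (gear_C (Suc m) k + (gear_C_tilde (Suc m) k)\<^sup>T))
       (gear_C (Suc m) k)"
  note carriers = gear_C_carrier[OF assms(1), of k] gear_C_tilde_carrier[OF assms(1), of k]
  have T: "T \<in> carrier_mat (2 * m + 1) (2 * m + 1)"
    unfolding T_def by (rule three_block_mat_dim) (use carriers in auto)
  have T_index: "T $$ (p, q) =
    (if p = 0 \<or> q = 0 then 0
     else if p \<le> m then
       if q \<le> m then c (int p - int q) / (4 * \<phi>\<^sup>2)
       else (c (int p - (int q - int m)) + c (int p - (int q - int m) - 1)) / (4 * \<phi>\<^sup>2)
     else
       if q \<le> m then (c (int p - int m - int q) + c (int p - int m - int q + 1)) / (4 * \<phi>\<^sup>2)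
       else c (int p - int q))"
  proof -
    have C: "gear_C (Suc m) k $$ (i, j) = c (int i - int j)" if "i < m" "j < m" for i j
      using gear_C_index[OF assms(1) that] neg[of "int i - int j"] by (simp add: c_def)
    have Ct': "gear_C_tilde (Suc m) k $$ (i, j) = c (int j - int i + 1)" if "i < m" "j < m" for i j
      using gear_C_tilde_index[OF assms(1) that] by (simp add: c_def)
    have Ct: "gear_C_tilde (Suc m) k $$ (i, j) = c (int i - int j - 1)" if "i < m" "j < m" for i j
    proof -
      have "int i - int j - 1 = - (int j - int i + 1)" by simp
      then show ?thesis using Ct'[OF that] by (simp only: neg)
    qed
    have t: "(gear_C_tilde (Suc m) k)\<^sup>T $$ (i, j) = c (int i - int j + 1)" if "i < m" "j < m" for i j
      using that carriers Ct' by simp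
    show ?thesis
      unfolding T_def
      by (subst three_block_mat_index[where m = m])
        (use carriers pq in \<open>auto simp: C Ct t of_nat_diff algebra_simps add_divide_distrib simp del: index_transpose_mat(1)\<close>)
  qed
  have "gear_B (Suc m) k = F \<cdot>\<^sub>m T"
    unfolding gear_B_def gear_phi_def Let_def T_def F_def \<phi>_def by simp
  then have "gear_B (Suc m) k $$ (p, q) = b * (4 * \<phi>\<^sup>2 * T $$ (p, q))"
    using T pq by (simp add: F)
  also have "4 * \<phi>\<^sup>2 * T $$ (p, q) = inc_row m q (\<lambda>y. inc_row m p (\<lambda>x. c (x - y)))"
    unfolding T_index using \<phi> neighbours[of "int p - int q"]
    by (simp add: inc_row_def) (auto simp: algebra_simps)
  finally show ?thesis by (simp add: b_def c_def)
qed


section \<open>Assembling \<open>L_even\<close>\<close>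

text \<open>By bilinearity each mode contributes separately, the constant one as a rank-one term in
  the hub distances.\<close>

lemma inc_row_cos_series:
  "inc_row m q (\<lambda>y. inc_row m p (\<lambda>x. cos_series m \<alpha> \<beta> (x - y)))
    = \<alpha> * inc_row m p (\<lambda>_. 1) * inc_row m q (\<lambda>_. 1) + (\<Sum>k = 1..(m - 1) div 2. \<beta> k *
        inc_row m q (\<lambda>y. inc_row m p (\<lambda>x. cos (2 * pi * real k * of_int (x - y) / real m))))"
proof -
  have "inc_row m p (\<lambda>x. cos_series m \<alpha> \<beta> (x - y)) = \<alpha> * inc_row m p (\<lambda>_. 1) + (\<Sum>k = 1..(m - 1) div 2.
      \<beta> k * inc_row m p (\<lambda>x. cos (2 * pi * real k * of_int (x - y) / real m)))" for y
    unfolding cos_series_def inc_row_add inc_row_sum inc_row_mult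
    by (simp add: inc_row_const[of m p \<alpha>])
  then show ?thesis
    by (simp only: inc_row_add inc_row_sum inc_row_mult
      inc_row_const[of m q "inc_row m p (\<lambda>_. 1)"] mult.assoc)
qed

text \<open>The coefficients are those of the identity matrix, \<open>1 / m\<close> and
  \<open>2 / m\<close>, divided by the squared eigenvalues of the Gram matrix.\<close>

lemma L_even_eq:
  assumes "m \<ge> 3" "odd m"
  shows "L_even (Suc m) = proj_inc_mat m * circ_mat m (cos_series m
      ((2 * real m + 1)\<^sup>2 / (real m * (real m + 5)\<^sup>2))
      (\<lambda>k. 2 / (real m * (3 + 2 * cos (2 * pi * real k / real m))\<^sup>2))) * (proj_inc_mat m)\<^sup>T"
    (is "_ = ?W * circ_mat m (cos_series m ?\<alpha> ?\<beta>) * ?W\<^sup>T")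
proof (rule eq_matI)
  let ?R = "?W * circ_mat m (cos_series m ?\<alpha> ?\<beta>) * ?W\<^sup>T" and ?M = "2 * real m + 1"
  let ?S = "finsum (module_mat TYPE(real) (2 * m + 1) (2 * m + 1)) (gear_B (Suc m)) {1..(m - 1) div 2}"
  have m: "m > 0" using assms by simp
  have L: "L_even (Suc m) = gear_A (Suc m) + ?S" unfolding L_even_def by simp
  have fs: "?S \<in> carrier_mat (2 * m + 1) (2 * m + 1)"
    "p < 2 * m + 1 \<Longrightarrow> q < 2 * m + 1 \<Longrightarrow> ?S $$ (p, q) = (\<Sum>k = 1..(m - 1) div 2. gear_B (Suc m) k $$ (p, q))" for p q
    using index_finsum_mat[where S = "{1..(m - 1) div 2}", OF _ gear_B_carrier[OF assms(1)]] by auto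
  show "dim_row (L_even (Suc m)) = dim_row ?R" "dim_col (L_even (Suc m)) = dim_col ?R"
    unfolding L using fs(1) proj_inc_mat_carrier[of m] by auto
  fix p q assume "p < dim_row ?R" "q < dim_col ?R"
  then have pq: "p < 2 * m + 1" "q < 2 * m + 1" using proj_inc_mat_carrier[of m] by auto
  let ?a = "inc_row m p (\<lambda>_. 1)" and ?b = "inc_row m q (\<lambda>_. 1)"
  let ?s = "\<Sum>k = 1..(m - 1) div 2. ?\<beta> k *
    inc_row m q (\<lambda>y. inc_row m p (\<lambda>x. cos (2 * pi * real k * of_int (x - y) / real m)))"
  \<comment> \<open>With \<open>r = m\<close> and \<open>M = 2 * m + 1\<close>, the centred product
    in \<open>A\<close> is the constant mode together with all corrections coming from the
    projection.\<close>
  have expand: "\<alpha> * (a - 3 * r / M) * (b - 3 * r / M) + t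
    = (\<alpha> * a * b + t) - 3 * (r * \<alpha>) / M * (a + b) + 9 * (r * \<alpha>) * r / M\<^sup>2" for \<alpha> a b r M t :: real
    by (simp add: power2_eq_square algebra_simps add_divide_distrib diff_divide_distrib)
  have "L_even (Suc m) $$ (p, q) = gear_A (Suc m) $$ (p, q) + ?S $$ (p, q)"
    unfolding L using fs(1) pq by simp
  also have "?S $$ (p, q) = ?s"
    unfolding fs(2)[OF pq] by (intro sum.cong refl gear_B_index) (use assms pq in auto)
  also have "gear_A (Suc m) $$ (p, q) = ?\<alpha> * (?a - 3 * real m / ?M) * (?b - 3 * real m / ?M)"
    by (rule gear_A_index[OF assms(1) pq])
  also have "\<dots> + ?s = (?\<alpha> * ?a * ?b + ?s) - 3 * (real m * ?\<alpha>) / ?M * (?a + ?b)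
      + 9 * (real m * ?\<alpha>) * real m / ?M\<^sup>2"
    by (rule expand)
  also have "\<dots> = ?R $$ (p, q)"
    unfolding inc_row_cos_series[symmetric]
    by (rule proj_inc_circ_proj_inc_index[symmetric, OF m periodic_cos_series[OF m] sum_cos_series _ pq])
      (simp add: cos_series_def)
  finally show "L_even (Suc m) $$ (p, q) = ?R $$ (p, q)" .
qed

theorem theorem3:
  fixes n :: nat and P U :: "real mat"
  assumes "n \<ge> 4" and "even n"
    and "P = 1\<^sub>m (2 * n - 1) - (1 / real (2 * n - 1)) \<cdot>\<^sub>m J_mat (2 * n - 1)"
    and "U = (- (1 / 2)) \<cdot>\<^sub>m (P * gear_D n * P)"
  shows "L_even n = mp_inverse U"
proof -
  define m where "m = n - 1"
  have n: "n = Suc m" and m3: "m \<ge> 3" and odd: "odd m" and m: "m > 0"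
    using assms(1,2) by (auto simp: m_def)
  let ?W = "proj_inc_mat m" and ?\<mu> = "\<lambda>k. 3 + 2 * cos (2 * pi * real k / real m)"
  let ?X = "circ_mat m (cos_series m ((2 * real m + 1)\<^sup>2 / (real m * (real m + 5)\<^sup>2))
    (\<lambda>k. 2 / (real m * (?\<mu> k)\<^sup>2)))"
  have "2 * n - 1 = 2 * m + 1" using n by simp
  then have U: "U = ?W * ?W\<^sup>T"
    using gear_gram[OF m3] assms(3,4) unfolding n by simp
  \<comment> \<open>Each of these eigenvalues is at least \<open>1\<close>.\<close>
  have \<mu>: "?\<mu> k \<noteq> 0" for k using cos_ge_minus_one[of "2 * pi * real k / real m"] by linarith
  have cancel: "x * (x * (2 / (r * x\<^sup>2))) = 2 / r" if "x \<noteq> 0" for x r :: real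
    using that by (simp add: power2_eq_square)
  have pos: "real m > 0" "real m + 5 \<noteq> 0" "2 * real m + 1 \<noteq> 0" using m by linarith+
  \<comment> \<open>Each Gram factor multiplies every coefficient by its eigenvalue; two of them
    cancel the inverse squares and leave the expansion of the identity.\<close>
  have "(?W\<^sup>T * ?W) * ((?W\<^sup>T * ?W) * ?X) = circ_mat m (cos_series m (1 / real m) (\<lambda>_. 2 / real m))"
    unfolding gram_mult_cos_series[OF m] cancel[OF \<mu>] using pos by (simp add: power2_eq_square)
  also have "\<dots> = 1\<^sub>m m"
    by (rule eq_matI) (auto simp: circ_mat_def cos_series_delta[OF odd])
  finally have "is_mp_inverse U (?W * ?X * ?W\<^sup>T)"
    unfolding U by (rule is_mp_inverse_gram[OF proj_inc_mat_carrier circ_mat_carrier])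
  then show ?thesis
    using mp_inverse_eqI L_even_eq[OF m3 odd] n by simp
qed

end
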